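(* Let $d\in\mathbb{N}$ and let $k$ be an integer with $0\le k\le d-1$. For each $n\in\mathbb{N}$, let $\mathcal{F}_n$ be a family of closed convex sets in $\mathbb{R}^d$. Suppose that $\{\mathcal{F}_n\}_{n\in\mathbb{N}}$ satisfies the heterochromatic $(\aleph_0,k+2)$-property (with respect to $k$-flats) and that $$\liminf_{n\to\infty}\sigma(\mathcal{F}_n)>0.$$ Then there is a finite set $\mathcal{T}$ of $k$-flats and an index set $I\subseteq\mathbb{N}$ with $\mathbb{N}\setminus I$ finite such that for every $n\in I$ and every $F\in\mathcal{F}_n$ some $k$-flat in $\mathcal{T}$ intersects $F$; i.e. a finite set of $k$-flats pierces all but finitely many of the families $\mathcal{F}_n$.
   Context: A $k$-flat is a $k$-dimensional affine subspace of $\mathbb{R}^d$; it pierces a set $F$ if it intersects $F$. For a set $S\subseteq\mathbb{R}^d$, the out-radius $R_S$ is the radius of the smallest closed ball containing $S$ and the in-radius $r_S$ is the radius of the largest closed ball contained in $S$; the condition number is $\sigma(S)=r_S/R_S$, and for a family $\mathcal{F}$, $\sigma(\mathcal{F})=\min\{\sigma(S): S\in\mathcal{F}\}$. An infinite sequence of sets $\{B_n\}_{n\in\mathbb{N}}$ is a heterochromatic sequence of $\{\mathcal{F}_n\}_{n\in\mathbb{N}}$ if there is a strictly increasing sequence of natural numbers $\{i_n\}$ with $B_n\in\mathcal{F}_{i_n}$ for all $n$. A sequence $\{B_n\}$ is $k$-dependent if there exist a $k$-flat $K$ and $k+2$ distinct indices $i_1,\dots,i_{k+2}$ with $K\cap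 B_{i_j}\neq\emptyset$ for all $j$. The collection $\{\mathcal{F}_n\}$ satisfies the heterochromatic $(\aleph_0,k+2)$-property if every heterochromatic sequence of $\{\mathcal{F}_n\}$ is $k$-dependent. *)

theory Defs
  imports "HOL-Analysis.Analysis"
begin

definition k_flat :: "nat \<Rightarrow> ('a::euclidean_space) set \<Rightarrow> bool" where
  "k_flat k K \<longleftrightarrow> affine K \<and> aff_dim K = int k"

definition pierces :: "('a::euclidean_space) set \<Rightarrow> 'a set \<Rightarrow> bool" where
  "pierces K S \<longleftrightarrow> K \<inter> S \<noteq> {}"

(* For nonempty bounded S the infimum is attained, so this is the radius of the smallest
   enclosing closed ball; for unbounded S it is \<infinity>. *)
definition out_radius :: "('a::euclidean_space) set \<Rightarrow> ennreal" where
  "out_radius S = (INF r\<in>{r. 0 \<le> r \<and> (\<exists>c. S \<subseteq> cball c r)}. ennreal r)"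

(* For nonempty closed bounded S the supremum is attained (with r = 0 if S has empty interior),
   so this is the radius of the largest closed ball contained in S. *)
definition in_radius :: "('a::euclidean_space) set \<Rightarrow> ennreal" where
  "in_radius S = (SUP r\<in>{r. 0 \<le> r \<and> (\<exists>c. cball c r \<subseteq> S)}. ennreal r)"

(* The division of ennreal gives 0 / 0 = 0 and x / \<infinity> = 0, also for x = \<infinity>. Hence the sets for
   which the quotient is not defined as a ratio of positive reals (the empty set, singletons,
   unbounded sets) have condition number 0. *)
definition cond_number :: "('a::euclidean_space) set \<Rightarrow> ennreal" where
  "cond_number S = in_radius S / out_radius S"

(* An infimum, since a minimum need not exist for an infinite family; \<infinity> for the empty family. *)
definition family_cond_number :: "('a::euclidean_space) set set \<Rightarrow> ennreal" where
  "family_cond_number F = (INF S\<in>F. cond_number S)"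

definition heterochromatic_seq ::
    "(nat \<Rightarrow> ('a::euclidean_space) set set) \<Rightarrow> (nat \<Rightarrow> 'a set) \<Rightarrow> bool" where
  "heterochromatic_seq F B \<longleftrightarrow> (\<exists>i::nat \<Rightarrow> nat. strict_mono i \<and> (\<forall>n. B n \<in> F (i n)))"

(* The indices in J are distinct, but the sets they index may coincide. *)
definition k_dependent :: "nat \<Rightarrow> (nat \<Rightarrow> ('a::euclidean_space) set) \<Rightarrow> bool" where
  "k_dependent k B \<longleftrightarrow>
    (\<exists>K J. k_flat k K \<and> card J = k + 2 \<and> (\<forall>j\<in>J. pierces K (B j)))"

definition heterochromatic_property ::
    "nat \<Rightarrow> (nat \<Rightarrow> ('a::euclidean_space) set set) \<Rightarrow> bool" where
  "heterochromatic_property k F \<longleftrightarrow> (\<forall>B. heterochromatic_seq F B \<longrightarrow> k_dependent k B)"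

end

(* Suppose that no finite set of flats works. Then some ultrafilter U on sets contains every tail
   of the sequence of families and, for every k-flat K, the collection of sets missing K. Lift
   points s to (s, 1) in R^d x R, so that k + 2 points lie on a k-flat iff their lifts are linearly
   dependent. It suffices that the sets S_1, ..., S_{k+2} admit no dependent choice of lifted points
   for U-almost all S_1, for U-almost all S_2, and so on: a diagonal choice then yields a
   heterochromatic sequence that is not k-dependent.

   The innermost quantifier is removed by a limit along U. As S is squeezed between two concentric
   balls of bounded ratio, the directions of its lifted points converge to a single y: otherwise the
   ball inside S is so large, relative to its distance from the origin, that a fixed low-dimensional
   subspace meets U-almost all S, and U avoids every flat. Dependence of S_1, ..., S_{k+2} therefore
   passes to dependence of S_1, ..., S_{k+1} modulo y, and one continues in the quotient by y. The
   only exception is that in the last step the sets may escape to infinity without a limit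
   direction, which is harmless since S_1 is compact. *)

theory Submission
  imports Defs
begin


section \<open>Ultrafilters and convergence along them\<close>

definition ultrafilter :: "'a filter \<Rightarrow> bool" where
  "ultrafilter U \<longleftrightarrow> U \<noteq> bot \<and> (\<forall>P. eventually P U \<or> eventually (\<lambda>x. \<not> P x) U)"

lemma not_eventually_ultrafilter:
  assumes "ultrafilter U"
  shows "\<not> eventually P U \<longleftrightarrow> eventually (\<lambda>x. \<not> P x) U"
proof
  assume "eventually (\<lambda>x. \<not> P x) U"
  show "\<not> eventually P U"
  proof
    assume "eventually P U"
    with \<open>eventually (\<lambda>x. \<not> P x) U\<close> have "eventually (\<lambda>x. False) U"
      by eventually_elim simp
    then show False
      using assms by (simp add: ultrafilter_def trivial_limit_def)
  qed
qed (use assms in \<open>auto simp: ultrafilter_def\<close>)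

text \<open>Zorn's lemma gives a minimal proper filter below \<open>F\<close>: a nonempty chain of
  proper filters is a filter base, so its infimum is proper.\<close>

lemma ultrafilter_exists:
  assumes "F \<noteq> bot"
  shows "\<exists>U\<le>F. ultrafilter U"
proof -
  let ?A = "{G. G \<le> F \<and> G \<noteq> bot}"
  have "\<exists>m\<in>?A. \<forall>a\<in>?A. m \<ge> a \<longrightarrow> a = m"
  proof (rule predicate_Zorn)
    show "partial_order_on ?A (relation_of (\<ge>) ?A)"
      by (rule partial_order_on_relation_ofI) auto
    fix C assume C: "C \<in> Chains (relation_of (\<ge>) ?A)"
    show "\<exists>u\<in>?A. \<forall>a\<in>C. a \<ge> u"
    proof (cases "C = {}")
      case True
      then show ?thesis using assms by auto
    next
      case False
      have sub: "C \<subseteq> ?A" using C by (auto simp: Chains_def relation_of_def)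
      have "Inf C \<noteq> bot"
      proof
        assume "Inf C = bot"
        then have "eventually (\<lambda>x. False) (Inf C)" by simp
        moreover have "\<exists>x\<in>C. x \<le> inf a b" if "a \<in> C" "b \<in> C" for a b
          using C that by (auto simp: Chains_def relation_of_def)
        ultimately have "\<exists>b\<in>C. eventually (\<lambda>x. False) b"
          using False by (subst (asm) eventually_Inf_base) auto
        then show False using sub by (auto simp: trivial_limit_def)
      qed
      moreover have "Inf C \<le> F"
        using False sub by (auto intro: Inf_lower2)
      ultimately show ?thesis by (auto intro: Inf_lower)
    qed
  qed
  then obtain m where m: "m \<le> F" "m \<noteq> bot"
    and min: "\<And>a. a \<le> F \<Longrightarrow> a \<noteq> bot \<Longrightarrow> a \<le> m \<Longrightarrow> a = m" by auto
  \<comment> \<open>Restricting \<open>m\<close> to \<open>P\<close> either yields the improper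
    filter, so that \<open>\<not> P\<close> holds eventually, or by minimality changes
    nothing.\<close>
  have "eventually P m \<or> eventually (\<lambda>x. \<not> P x) m" for P
  proof (cases "inf m (principal {x. P x}) = bot")
    case True
    then have "eventually (\<lambda>x. False) (inf m (principal {x. P x}))" by simp
    then show ?thesis by (simp add: eventually_inf_principal)
  next
    case False
    then have "inf m (principal {x. P x}) = m"
      using min m by (meson inf.cobounded1 order.trans)
    then show ?thesis
      using eventually_inf_principal[of P m "{x. P x}"] by simp
  qed
  then show ?thesis using m by (auto simp: ultrafilter_def)
qed

text \<open>Compactness supplies a cluster point. A neighbourhood of it that is not entered
  eventually would be avoided eventually, so along an ultrafilter the cluster point is a
  limit.\<close>

lemma ultrafilter_tendsto_compact:
  assumes U: "ultrafilter U" and ev: "\<forall>\<^sub>F x in U. f x \<in> C" and C: "compact C"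
  shows "\<exists>l\<in>C. (f \<longlongrightarrow> l) U"
proof -
  have "filtermap f U \<noteq> bot" using U by (simp add: ultrafilter_def filtermap_bot_iff)
  moreover have "eventually (\<lambda>x. x \<in> C) (filtermap f U)" using ev by (simp add: eventually_filtermap)
  ultimately obtain l where l: "l \<in> C" "inf (nhds l) (filtermap f U) \<noteq> bot"
    using C unfolding compact_filter by blast
  have "\<forall>\<^sub>F x in U. f x \<in> N" if "open N" "l \<in> N" for N
  proof (rule ccontr)
    assume "\<not> ?thesis"
    then have "\<forall>\<^sub>F x in U. f x \<notin> N" using not_eventually_ultrafilter[OF U] by auto
    then have "eventually (\<lambda>x. x \<notin> N) (filtermap f U)" by (simp add: eventually_filtermap)
    moreover have "eventually (\<lambda>x. x \<in> N) (nhds l)" using that by (rule eventually_nhds_in_open)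
    ultimately have "eventually (\<lambda>x. False) (inf (nhds l) (filtermap f U))"
      unfolding eventually_inf by blast
    then show False using l by (simp add: trivial_limit_def)
  qed
  then show ?thesis using l by (auto simp: tendsto_def)
qed

lemma ultrafilter_tendsto_bounded:
  fixes f :: "'a \<Rightarrow> 'b::euclidean_space"
  assumes "ultrafilter U" and "\<forall>\<^sub>F x in U. norm (f x) \<le> D"
  shows "\<exists>l. (f \<longlongrightarrow> l) U"
proof -
  have "\<forall>\<^sub>F x in U. f x \<in> cball 0 D" using assms(2) by simp
  from ultrafilter_tendsto_compact[OF assms(1) this compact_cball] show ?thesis by blast
qed

section \<open>Dependent lifts and quotient maps\<close>

definition lin_dep :: "('a \<times> real \<Rightarrow> 'b::real_normed_vector) \<Rightarrow> 'a set list \<Rightarrow> bool"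
  where "lin_dep p Ss \<longleftrightarrow>
    (\<exists>s b. (\<forall>i<length Ss. s i \<in> Ss ! i) \<and> (\<exists>i<length Ss. b i \<noteq> (0::real))
         \<and> (\<Sum>i<length Ss. b i *\<^sub>R p (s i, 1)) = 0)"

text \<open>Idempotent maps model the successive quotients: \<open>p\<close> is the quotient map by its kernel.\<close>

definition proj_along :: "('b::real_vector \<Rightarrow> 'b) \<Rightarrow> 'b set \<Rightarrow> bool" where
  "proj_along p Y \<longleftrightarrow> linear p \<and> (\<forall>v. p (p v) = p v) \<and> (\<forall>v. p v = 0 \<longrightarrow> v \<in> span Y)"

section \<open>Limit directions of fat convex sets\<close>

lemma norm_fst_le_norm: "norm (fst z) \<le> norm z"
  using norm_fst_le[of "fst z" "snd z"] by simp

lemma norm_snd_le_norm: "norm (snd z) \<le> norm z"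
  using norm_snd_le[of "snd z" "fst z"] by simp

text \<open>A span of at most \<open>k + 1\<close> vectors meets height 1 in a flat of dimension at
  most \<open>k\<close>, so \<open>eventually_avoids\<close> expresses in linear terms that
  \<open>U\<close> avoids every k-flat.\<close>

locale fat_ultrafilter =
  fixes U :: "'a::euclidean_space set filter" and k :: nat and M :: real
  assumes ultra: "ultrafilter U"
    and eventually_fat: "\<forall>\<^sub>F S in U. \<exists>c r. 0 < r \<and> cball c r \<subseteq> S \<and> S \<subseteq> cball c (M * r)"
    and eventually_compact: "\<forall>\<^sub>F S in U. compact S"
    and eventually_convex: "\<forall>\<^sub>F S in U. convex S"
    and eventually_avoids: "\<And>Y. finite Y \<Longrightarrow> card Y \<le> k + 1 \<Longrightarrow> \<forall>\<^sub>F S in U. \<forall>s\<in>S. (s, 1::real) \<notin> span Y"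
begin

lemma U_not_bot: "U \<noteq> bot"
  using ultra by (simp add: ultrafilter_def)

lemma no_common_span:
  assumes "finite Y" "card Y \<le> k + 1" "\<forall>\<^sub>F S in U. \<exists>s\<in>S. (s, 1::real) \<in> span Y"
  shows False
proof -
  from eventually_avoids[OF assms(1,2)] assms(3) have "\<forall>\<^sub>F S in U. False"
    by eventually_elim blast
  then show False using U_not_bot by (simp add: trivial_limit_def)
qed

text \<open>The bound \<open>card Y \<le> k\<close> leaves room for one more vector: contradictions
  arise from a \<open>v\<close> such that almost all lifted sets meet the span of
  \<open>insert v Y\<close>.\<close>

context
  fixes p :: "'a \<times> real \<Rightarrow> 'a \<times> real" and Y
  assumes p: "proj_along p Y" and Y: "finite Y" "card Y \<le> k"
begin

lemma linear_p: "linear p" and p_idem: "p (p v) = p v" and kernel_p: "p v = 0 \<Longrightarrow> v \<in> span Y"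
  using p unfolding proj_along_def by blast+

lemma span_insertI:
  assumes "p (v - a *\<^sub>R z) = 0" shows "v \<in> span (insert z Y)"
  using kernel_p[OF assms] by (auto simp: span_insert)

lemma p_limit_fixed:
  assumes "((\<lambda>S. p (f S)) \<longlongrightarrow> v) U" shows "p v = v"
proof -
  have "((\<lambda>S. p (p (f S))) \<longlongrightarrow> p v) U"
    using linear_p assms unfolding linear_conv_bounded_linear by (rule bounded_linear.tendsto)
  then show ?thesis using assms U_not_bot by (simp add: p_idem tendsto_unique)
qed

lemma p_misses: "\<forall>\<^sub>F S in U. \<forall>s\<in>S. p (s, 1) \<noteq> 0"
proof -
  have "card Y \<le> k + 1" using Y(2) by simp
  from eventually_avoids[OF Y(1) this] show ?thesis by eventually_elim (use kernel_p in blast)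
qed

text \<open>By idempotence \<open>p u - u\<close> lies in the kernel; if its height were nonzero,
  rescaling would put a vector of height 1 into the kernel.\<close>

lemma snd_p:
  assumes ht: "\<And>w. p (w, 1) \<noteq> 0" shows "snd (p u) = snd u"
proof (rule ccontr)
  let ?v = "p u - u"
  assume "snd (p u) \<noteq> snd u"
  then have "snd ?v \<noteq> 0" by simp
  then have "inverse (snd ?v) *\<^sub>R ?v = (inverse (snd ?v) *\<^sub>R fst ?v, 1)"
    by (simp add: prod_eq_iff)
  moreover have "p (inverse (snd ?v) *\<^sub>R ?v) = 0"
    by (simp only: linear_scale[OF linear_p] linear_diff[OF linear_p] p_idem) simp
  ultimately have "p (inverse (snd ?v) *\<^sub>R fst ?v, 1) = 0" by (simp only:)
  then show False using ht by blast
qed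

text \<open>Otherwise the projected lifts of the centres converge to some \<open>v\<close>, and
  almost all balls have room for the small shift that carries the projected lift to
  \<open>v\<close>; a single span then meets almost all sets.\<close>

lemma no_bounded_balls:
  assumes ht: "\<And>w. p (w, 1) \<noteq> 0" and "\<rho> > 0"
    and ev: "\<forall>\<^sub>F S in U. \<exists>x. norm (p (x, 1)) \<le> D \<and> cball x \<rho> \<subseteq> S"
  shows False
proof -
  define x where "x S = (SOME x. norm (p (x, 1)) \<le> D \<and> cball x \<rho> \<subseteq> S)" for S
  have x: "\<forall>\<^sub>F S in U. norm (p (x S, 1)) \<le> D \<and> cball (x S) \<rho> \<subseteq> S"
    using ev unfolding x_def by eventually_elim (rule someI_ex)
  then have "\<forall>\<^sub>F S in U. norm (p (x S, 1)) \<le> D" by (auto elim: eventually_mono)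
  from ultrafilter_tendsto_bounded[OF ultra this]
  obtain v where v: "((\<lambda>S. p (x S, 1)) \<longlongrightarrow> v) U" by blast
  have pv: "p v = v" using p_limit_fixed[OF v] .
  have near: "\<forall>\<^sub>F S in U. dist (p (x S, 1)) v < \<rho>" using v \<open>\<rho> > 0\<close> by (simp add: tendstoD)
  have "((\<lambda>S. snd (p (x S, 1))) \<longlongrightarrow> snd v) U" using v by (rule tendsto_snd)
  then have sv: "snd v = 1"
    using U_not_bot by (simp add: snd_p[OF ht] tendsto_const_iff)
  have "\<forall>\<^sub>F S in U. \<exists>s\<in>S. (s, 1::real) \<in> span (insert v Y)"
    using x near
  proof eventually_elim
    case (elim S)
    \<comment> \<open>The shift is horizontal because \<open>v\<close> and the projected lift both
      have height 1; it makes \<open>p (?s, 1)\<close> equal to \<open>v\<close>.\<close>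
    let ?s = "x S + (fst v - fst (p (x S, 1)))"
    have "norm (fst v - fst (p (x S, 1))) \<le> norm (v - p (x S, 1))"
      using norm_fst_le_norm[of "v - p (x S, 1)"] by simp
    then have "?s \<in> cball (x S) \<rho>" using elim by (simp add: dist_norm norm_minus_commute)
    moreover have "p ((?s, 1) - 1 *\<^sub>R v) = 0"
    proof -
      have "(?s, 1) - v = (x S, 1) - p (x S, 1)"
        using sv by (simp add: prod_eq_iff snd_p[OF ht])
      then show ?thesis by (simp add: linear_diff[OF linear_p] p_idem)
    qed
    ultimately show ?case using elim span_insertI by blast
  qed
  then show False
    by (rule no_common_span[rotated 2]) (use Y in \<open>auto simp: card_insert_if\<close>)
qed

text \<open>Here \<open>v\<close> is the limit of the lifted centres rescaled by the radii; since the balls have size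
  comparable to their distance from the origin, they meet the span of \<open>v\<close> modulo the kernel, unless
  the radii tend to infinity and \<open>v\<close> has height zero.\<close>

lemma large_sets_escape:
  assumes small: "\<forall>\<^sub>F S in U. 0 < r S \<and> cball (c S) (r S) \<subseteq> S \<and> norm (p (c S, 1)) \<le> C * r S"
  shows "card Y = k \<and> (\<forall>w. p (w, 1) \<noteq> 0) \<and> (\<forall>D. \<forall>\<^sub>F S in U. \<forall>s\<in>S. norm (p (s, 1)) > D)"
proof -
  define q where "q S = p (inverse (r S) *\<^sub>R (c S, 1))" for S
  have rq: "p (c S, 1) = r S *\<^sub>R q S" if "0 < r S" for S
    using that unfolding q_def linear_scale[OF linear_p] by simp
  have q_le: "\<forall>\<^sub>F S in U. norm (q S) \<le> C"
    using small
  proof eventually_elim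
    case (elim S)
    then have "norm (p (c S, 1)) = r S * norm (q S)" using rq[of S] by simp
    then have "r S * norm (q S) \<le> r S * C" using elim by (simp add: mult.commute)
    then show ?case using elim by (simp only: mult_le_cancel_left_pos)
  qed
  from ultrafilter_tendsto_bounded[OF ultra this]
  obtain v where v: "(q \<longlongrightarrow> v) U" by blast
  have pv: "p v = v" using p_limit_fixed v unfolding q_def .
  have pq: "p (q S) = q S" for S by (simp add: q_def p_idem)
  \<comment> \<open>A lift \<open>(w, 1)\<close> in the kernel could absorb heights, and the balls
    would then reach the span of \<open>v\<close> modulo the kernel.\<close>
  have ht: "p (w, 1) \<noteq> 0" for w
  proof
    assume w: "p (w, 1) = 0"
    have "\<forall>\<^sub>F S in U. dist (q S) v < 1 / (1 + norm w)"
      using v by (intro tendstoD) (auto intro!: divide_pos_pos add_pos_nonneg)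
    with small have "\<forall>\<^sub>F S in U. \<exists>s\<in>S. (s, 1::real) \<in> span (insert v Y)"
    proof eventually_elim
      case (elim S)
      \<comment> \<open>Subtracting a multiple of \<open>(w, 1)\<close> makes \<open>v - q S\<close>
        horizontal without changing its image under \<open>p\<close>. The threshold
        \<open>1 / (1 + norm w)\<close> keeps \<open>z\<close> in the unit ball, so moving the
        centre by \<open>r S *\<^sub>R z\<close> stays in \<open>S\<close>.\<close>
      define z where "z = fst (v - q S) - snd (v - q S) *\<^sub>R w"
      have "norm z \<le> norm (fst (v - q S)) + norm (snd (v - q S)) * norm w"
        using norm_triangle_ineq4[of "fst (v - q S)" "snd (v - q S) *\<^sub>R w"] by (simp add: z_def)
      also have "\<dots> \<le> norm (v - q S) + norm (v - q S) * norm w"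
        by (intro add_mono mult_right_mono norm_fst_le_norm norm_snd_le_norm norm_ge_zero)
      also have "\<dots> \<le> 1"
      proof -
        have "0 < 1 + norm w" by (simp add: add_pos_nonneg)
        then have "norm (v - q S) * (1 + norm w) < 1"
          using elim by (simp add: dist_norm norm_minus_commute field_simps)
        then show ?thesis by (simp add: algebra_simps)
      qed
      finally have z: "norm z \<le> 1" .
      then have "c S + r S *\<^sub>R z \<in> cball (c S) (r S)"
        using elim by (simp add: dist_norm)
      moreover have "p ((c S + r S *\<^sub>R z, 1) - r S *\<^sub>R v) = 0"
      proof -
        have "(z, 0) = (v - q S) - snd (v - q S) *\<^sub>R (w, 1)"
          by (simp add: z_def prod_eq_iff)
        then have pz: "p (z, 0) = v - q S"
          by (simp only: linear_diff[OF linear_p] linear_scale[OF linear_p] w pv pq) simp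
        have "(c S + r S *\<^sub>R z, 1) - r S *\<^sub>R v = (c S, 1) + r S *\<^sub>R (z, 0) - r S *\<^sub>R v"
          by simp
        then have "p ((c S + r S *\<^sub>R z, 1) - r S *\<^sub>R v) = p (c S, 1) + r S *\<^sub>R p (z, 0) - r S *\<^sub>R v"
          by (simp only: linear_diff[OF linear_p] linear_add[OF linear_p] linear_scale[OF linear_p] pv)
        also have "\<dots> = r S *\<^sub>R q S + r S *\<^sub>R (v - q S) - r S *\<^sub>R v"
          using rq[of S] elim by (simp only: pz)
        finally show ?thesis by (simp add: scaleR_diff_right)
      qed
      ultimately show ?case using elim span_insertI by blast
    qed
    then show False
    by (rule no_common_span[rotated 2]) (use Y in \<open>auto simp: card_insert_if\<close>)
  qed
  have sndq: "snd (q S) = inverse (r S)" for S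
    unfolding q_def by (simp add: snd_p[OF ht])
  \<comment> \<open>The height \<open>inverse (r S)\<close> of \<open>q S\<close> is bounded by its
    norm, hence by \<open>C\<close>: the radii stay away from 0.\<close>
  have r_ge: "\<forall>\<^sub>F S in U. 1 \<le> (C + 1) * r S \<and> C \<ge> 0"
    using small q_le
  proof eventually_elim
    case (elim S)
    have "inverse (r S) \<le> norm (q S)" using norm_snd_le_norm[of "q S"] elim by (simp add: sndq)
    then have "inverse (r S) \<le> C + 1" "0 \<le> C" using elim norm_ge_zero[of "q S"] by linarith+
    then show ?case using elim by (simp add: field_simps)
  qed
  then have C0: "C \<ge> 0" using eventually_happens'[OF U_not_bot] by blast
  \<comment> \<open>Bounded radii would bound the projected centres as well, while every ball
    contains one of fixed radius \<open>1 / (C + 1)\<close>.\<close>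
  have r_inf: "\<forall>\<^sub>F S in U. r S > R" for R
  proof (rule ccontr)
    assume "\<not> ?thesis"
    then have "\<forall>\<^sub>F S in U. \<not> r S > R" using not_eventually_ultrafilter[OF ultra] by blast
    with small r_ge have "\<forall>\<^sub>F S in U. \<exists>x. norm (p (x, 1)) \<le> C * R \<and> cball x (1 / (C + 1)) \<subseteq> S"
    proof eventually_elim
      case (elim S)
      have "norm (p (c S, 1)) \<le> C * R"
        using elim mult_left_mono[of "r S" R C] by linarith
      moreover have "1 / (C + 1) \<le> r S" using elim by (simp add: field_simps)
      ultimately show ?case using elim subset_cball[of "1 / (C + 1)" "r S" "c S"] by blast
    qed
    then show False using no_bounded_balls[OF ht, of "1 / (C + 1)"] C0 by simp
  qed
  have "((\<lambda>S. snd (q S)) \<longlongrightarrow> snd v) U" using v by (rule tendsto_snd)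
  have sv: "snd v = 0"
  proof (rule ccontr)
    assume "snd v \<noteq> 0"
    then have "\<forall>\<^sub>F S in U. dist (snd (q S)) (snd v) < \<bar>snd v\<bar> / 2"
      using \<open>snd v \<noteq> 0\<close> by (intro tendstoD[OF \<open>((\<lambda>S. snd (q S)) \<longlongrightarrow> snd v) U\<close>]) simp
    with small r_inf[of "2 / \<bar>snd v\<bar>"] have "\<forall>\<^sub>F S in U. False"
    proof eventually_elim
      case (elim S)
      have "inverse (r S) < \<bar>snd v\<bar> / 2"
        using elim \<open>snd v \<noteq> 0\<close> by (simp add: field_simps)
      moreover have "0 < inverse (r S)" "\<bar>inverse (r S) - snd v\<bar> < \<bar>snd v\<bar> / 2"
        using elim by (simp_all add: sndq dist_real_def)
      ultimately show ?case by linarith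
    qed
    then show False using U_not_bot by simp
  qed
  \<comment> \<open>Since \<open>v\<close> has height zero, the vector \<open>(0, 1)\<close> must
    supply the height of the lift. Adding both to \<open>Y\<close> stays within \<open>k + 1\<close>
    vectors if \<open>card Y < k\<close>.\<close>
  have "card Y = k"
  proof (rule ccontr)
    assume "card Y \<noteq> k"
    have "\<forall>\<^sub>F S in U. dist (q S) v < 1" using v by (simp add: tendstoD)
    with small have "\<forall>\<^sub>F S in U. \<exists>s\<in>S. (s, 1::real) \<in> span (insert v (insert (0, 1) Y))"
    proof eventually_elim
      case (elim S)
      let ?s = "c S + r S *\<^sub>R (fst v - fst (q S))"
      have "norm (fst v - fst (q S)) \<le> 1"
        using elim norm_fst_le_norm[of "v - q S"] by (simp add: dist_norm norm_minus_commute)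
      then have "?s \<in> cball (c S) (r S)"
        using elim by (simp add: dist_norm)
      moreover have "p (((?s, 1) - r S *\<^sub>R v) - 1 *\<^sub>R (0, 1)) = 0"
      proof -
        have "(?s, 1) - r S *\<^sub>R v - 1 *\<^sub>R (0, 1) = (c S, 1) - r S *\<^sub>R q S"
          using elim by (simp add: prod_eq_iff sv sndq algebra_simps)
        then show ?thesis
          using rq[of S] elim
          by (simp only: linear_diff[OF linear_p] linear_scale[OF linear_p] pq) simp
      qed
      then have "(?s, 1) - r S *\<^sub>R v \<in> span (insert (0, 1) Y)" by (rule span_insertI)
      then have "(?s, 1) \<in> span (insert v (insert (0, 1) Y))" by (auto simp: span_insert[of v])
      ultimately show ?case using elim by blast
    qed
    then show False
      by (rule no_common_span[rotated 2]) (use Y \<open>card Y \<noteq> k\<close> in \<open>auto simp: card_insert_if\<close>)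
  qed
  moreover have "\<forall>\<^sub>F S in U. \<forall>s\<in>S. norm (p (s, 1)) > D" for D
  proof (rule ccontr)
    assume "\<not> ?thesis"
    then have "\<forall>\<^sub>F S in U. \<not> (\<forall>s\<in>S. norm (p (s, 1)) > D)"
      using not_eventually_ultrafilter[OF ultra] by blast
    with small r_inf[of 1] eventually_convex have "\<forall>\<^sub>F S in U. \<exists>x. norm (p (x, 1)) \<le> D + C \<and> cball x 1 \<subseteq> S"
    proof eventually_elim
      case (elim S)
      then obtain s where s: "s \<in> S" "norm (p (s, 1)) \<le> D" by force
      \<comment> \<open>shrinking towards the near point \<open>s\<close> gives a unit ball at bounded distance\<close>
      define t where "t = inverse (r S)"
      have t: "0 < t" "t < 1" "t * r S = 1" using elim by (auto simp: t_def field_simps)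
      let ?x = "(1 - t) *\<^sub>R s + t *\<^sub>R c S"
      have "(?x, 1) = (1 - t) *\<^sub>R (s, 1) + t *\<^sub>R (c S, 1::real)" by (simp add: prod_eq_iff)
      then have "p (?x, 1) = (1 - t) *\<^sub>R p (s, 1) + t *\<^sub>R p (c S, 1)"
        by (simp only: linear_add[OF linear_p] linear_scale[OF linear_p])
      then have "norm (p (?x, 1)) \<le> (1 - t) * norm (p (s, 1)) + t * norm (p (c S, 1))"
        using t norm_triangle_ineq[of "(1 - t) *\<^sub>R p (s, 1)" "t *\<^sub>R p (c S, 1)"] by simp
      also have "\<dots> \<le> 1 * D + t * (C * r S)"
      proof (intro add_mono)
        show "(1 - t) * norm (p (s, 1)) \<le> 1 * D"
          using s t by (intro mult_mono) auto
        show "t * norm (p (c S, 1)) \<le> t * (C * r S)"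
          using elim t by (intro mult_left_mono) auto
      qed
      also have "t * (C * r S) = C" using t(3) by (simp add: mult.left_commute)
      finally have "norm (p (?x, 1)) \<le> D + C" by simp
      moreover have "cball ?x 1 \<subseteq> S"
      proof
        fix z assume z: "z \<in> cball ?x 1"
        have "c S + r S *\<^sub>R (z - ?x) \<in> cball (c S) (r S)"
          using z elim by (simp add: dist_norm norm_minus_commute)
        then have "c S + r S *\<^sub>R (z - ?x) \<in> S" using elim by blast
        then have "(1 - t) *\<^sub>R s + t *\<^sub>R (c S + r S *\<^sub>R (z - ?x)) \<in> S"
          using s t elim by (intro convexD) auto
        moreover have "(1 - t) *\<^sub>R s + t *\<^sub>R (c S + r S *\<^sub>R (z - ?x)) = z"
          using t by (simp add: scaleR_add_right)
        ultimately show "z \<in> S" by simp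
      qed
      ultimately show ?case by blast
    qed
    then show False using no_bounded_balls[OF ht, of 1] by simp
  qed
  ultimately show ?thesis using ht by blast
qed

text \<open>Let \<open>y\<close> be the limit direction of the centres. If the directions in
  \<open>S\<close> do not all approach \<open>y\<close>, almost every \<open>S\<close> has a point
  whose direction differs definitely from that of the centre, which bounds the norm of the projected
  centre by a multiple of the inner radius. This is the hypothesis of
  \<open>large_sets_escape\<close>.\<close>

lemma limit_direction_or_escape:
  "(\<exists>y. norm y = 1 \<and> p y = y \<and> (\<forall>e>0. \<forall>\<^sub>F S in U. \<forall>s\<in>S. dist (sgn (p (s, 1))) y < e)) \<or>
   card Y = k \<and> (\<forall>w. p (w, 1) \<noteq> 0) \<and> (\<forall>D. \<forall>\<^sub>F S in U. \<forall>s\<in>S. norm (p (s, 1)) > D)"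
proof -
  define P where "P S c r \<longleftrightarrow> 0 < r \<and> cball c r \<subseteq> S \<and> S \<subseteq> cball c (M * r)"
    for S :: "'a set" and c r
  define c where "c S = (SOME c. \<exists>r. P S c r)" for S
  define r where "r S = (SOME r. P S (c S) r)" for S
  have center: "c \<in> S" if "P S c r" for S c r
    using that centre_in_cball[of c r] unfolding P_def by (meson less_imp_le subsetD)
  have "\<forall>\<^sub>F S in U. \<exists>c r. P S c r" using eventually_fat unfolding P_def .
  then have "\<forall>\<^sub>F S in U. \<exists>r. P S (c S) r"
    unfolding c_def by eventually_elim (rule someI_ex)
  then have cr: "\<forall>\<^sub>F S in U. P S (c S) (r S)"
    unfolding r_def by eventually_elim (rule someI_ex)
  have "\<forall>\<^sub>F S in U. norm (sgn (p (c S, 1))) \<le> 1" by (simp add: norm_sgn)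
  from ultrafilter_tendsto_bounded[OF ultra this]
  obtain y where y: "((\<lambda>S. sgn (p (c S, 1))) \<longlongrightarrow> y) U" by blast
  have "\<forall>\<^sub>F S in U. norm (sgn (p (c S, 1))) = 1"
    using p_misses cr
  proof eventually_elim
    case (elim S)
    then have "c S \<in> S" using center by blast
    then show ?case using elim by (simp add: norm_sgn)
  qed
  moreover have "((\<lambda>S. norm (sgn (p (c S, 1)))) \<longlongrightarrow> norm y) U" using y by (rule tendsto_norm)
  ultimately have "((\<lambda>S. 1) \<longlongrightarrow> norm y) U"
    by (rule Lim_transform_eventually[rotated])
  then have ny: "norm y = 1"
    using U_not_bot by (simp add: tendsto_const_iff)
  have py: "p y = y"
  proof (rule p_limit_fixed)
    have "p (sgn (p v)) = sgn (p v)" for v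
      by (simp only: sgn_div_norm linear_scale[OF linear_p] p_idem)
    then show "((\<lambda>S. p (sgn (p (c S, 1)))) \<longlongrightarrow> y) U"
      using y by simp
  qed
  show ?thesis
  proof (cases "\<forall>e>0. \<forall>\<^sub>F S in U. \<forall>s\<in>S. dist (sgn (p (s, 1))) y < e")
    case True
    then show ?thesis using ny py by blast
  next
    case False
    then obtain e where e0: "e > 0" "\<not> (\<forall>\<^sub>F S in U. \<forall>s\<in>S. dist (sgn (p (s, 1))) y < e)"
      by blast
    then have e: "e > 0" "\<forall>\<^sub>F S in U. \<not> (\<forall>s\<in>S. dist (sgn (p (s, 1))) y < e)"
      unfolding not_eventually_ultrafilter[OF ultra] .
    obtain B where B: "B > 0" "\<And>v. norm (p v) \<le> B * norm v"
      using linear_bounded_pos[OF linear_p] by blast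
    have "\<forall>\<^sub>F S in U. dist (sgn (p (c S, 1))) y < e / 2" by (rule tendstoD[OF y]) (use e in simp)
    with p_misses cr e(2)
    have "\<forall>\<^sub>F S in U. 0 < r S \<and> cball (c S) (r S) \<subseteq> S \<and> norm (p (c S, 1)) \<le> (4 * B * M / e) * r S"
    proof eventually_elim
      case (elim S)
      then obtain s where s: "s \<in> S" "e \<le> dist (sgn (p (s, 1))) y" by (auto simp only: not_less ball_simps)
      let ?a = "p (c S, 1)" and ?b = "p (s, 1)"
      have cS: "c S \<in> S" using elim center by blast
      have a0: "?a \<noteq> 0" and b0: "?b \<noteq> 0" using elim cS s by auto
      \<comment> \<open>The direction of the centre is within \<open>e / 2\<close> of
        \<open>y\<close>. The distance of the directions times \<open>norm ?a\<close> is at most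
        \<open>2 * norm (?a - ?b)\<close>, and \<open>?a - ?b\<close> has norm at most
        \<open>B * (M * r S)\<close>, whence the constant \<open>4 * B * M / e\<close>.\<close>
      have "e / 2 \<le> norm (sgn ?a - sgn ?b)"
        using s elim dist_triangle[of "sgn ?b" y "sgn ?a"] by (simp add: dist_norm norm_minus_commute)
      then have "norm ?a * (e / 2) \<le> norm (norm ?a *\<^sub>R (sgn ?a - sgn ?b))"
        using mult_left_mono[OF _ norm_ge_zero[of ?a], of "e / 2" "norm (sgn ?a - sgn ?b)"] by simp
      also have "norm ?a *\<^sub>R (sgn ?a - sgn ?b) = (?a - ?b) + (norm ?b - norm ?a) *\<^sub>R sgn ?b"
        using a0 b0 by (simp add: sgn_div_norm algebra_simps)
      also have "norm \<dots> \<le> norm (?a - ?b) + \<bar>norm ?b - norm ?a\<bar>"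
        using norm_triangle_ineq[of "?a - ?b" "(norm ?b - norm ?a) *\<^sub>R sgn ?b"] b0
        by (simp add: norm_sgn)
      also have "\<dots> \<le> 2 * norm (?a - ?b)"
        using norm_triangle_ineq3[of ?b ?a] by (simp add: norm_minus_commute)
      also have "?a - ?b = p (c S - s, 0)"
        by (simp flip: linear_diff[OF linear_p])
      also have "2 * norm \<dots> \<le> 2 * (B * (M * r S))"
      proof -
        have "norm (c S - s) \<le> M * r S" using elim s by (auto simp: P_def dist_norm)
        then have "norm (c S - s, 0::real) \<le> M * r S" by (simp add: norm_prod_def)
        then show ?thesis
          using B(2)[of "(c S - s, 0)"] mult_left_mono[of "norm (c S - s, 0::real)" "M * r S" B] B(1)
          by linarith
      qed
      finally have "norm ?a \<le> (4 * B * M / e) * r S" using e by (simp add: field_simps)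
      then show ?case using elim by (auto simp: P_def)
    qed
    from large_sets_escape[OF this] show ?thesis by (rule disjI2)
  qed
qed

end
end


section \<open>Iterated quantifiers along a filter\<close>

text \<open>Lists grow at the head, so the set chosen last, which is the innermost quantifier, comes first.\<close>

fun ev_seq :: "'a filter \<Rightarrow> nat \<Rightarrow> ('a list \<Rightarrow> bool) \<Rightarrow> 'a list \<Rightarrow> bool" where
  "ev_seq U 0 P xs = P xs"
| "ev_seq U (Suc m) P xs = (\<forall>\<^sub>F x in U. ev_seq U m P (x # xs))"

text \<open>The recursion removes the outermost quantifier; the limit argument needs access to the
  innermost one.\<close>

lemma ev_seq_Suc_inner:
  "ev_seq U (Suc m) P xs = ev_seq U m (\<lambda>ys. \<forall>\<^sub>F y in U. P (y # ys)) xs"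
proof (induction m arbitrary: xs)
  case (Suc m)
  have "ev_seq U (Suc (Suc m)) P xs = (\<forall>\<^sub>F x in U. ev_seq U (Suc m) P (x # xs))"
    by (rule ev_seq.simps)
  also have "\<dots> = ev_seq U (Suc m) (\<lambda>ys. \<forall>\<^sub>F y in U. P (y # ys)) xs"
    unfolding Suc.IH by simp
  finally show ?case .
qed simp

lemma ev_seq_mono:
  assumes "ev_seq U m P xs" and "\<And>ys. P ys \<Longrightarrow> Q ys"
  shows "ev_seq U m Q xs"
  using assms(1)
proof (induction m arbitrary: xs)
  case (Suc m)
  then show ?case by (auto elim: eventually_mono)
qed (simp add: assms(2))

text \<open>The new map is \<open>p\<close> followed by the orthogonal projection that kills
  \<open>y\<close>. As \<open>p\<close> fixes \<open>y\<close>, it also fixes the result, so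
  idempotence persists, and only the line of \<open>y\<close> joins the kernel.\<close>

lemma proj_along_extend:
  fixes p :: "'b::real_inner \<Rightarrow> 'b"
  assumes p: "proj_along p Y" and y: "norm y = 1" "p y = y"
  shows "proj_along (\<lambda>v. p v - (y \<bullet> p v) *\<^sub>R y) (insert y Y)"
proof -
  have linear_p: "linear p" and p_idem: "\<And>v. p (p v) = p v" and kernel_p: "\<And>v. p v = 0 \<Longrightarrow> v \<in> span Y"
    using p unfolding proj_along_def by blast+
  let ?p = "\<lambda>v. p v - (y \<bullet> p v) *\<^sub>R y"
  have yy: "y \<bullet> y = 1" using y by (simp add: dot_square_norm)
  have "linear ?p"
    by (rule linearI)
      (simp_all add: linear_add[OF linear_p] linear_scale[OF linear_p] inner_add_right scaleR_add_left scaleR_diff_right)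
  moreover have "?p (?p v) = ?p v" for v
  proof -
    have "p (?p v) = ?p v"
      by (simp add: linear_diff[OF linear_p] linear_scale[OF linear_p] p_idem y)
    then show ?thesis by (simp add: inner_diff_right yy)
  qed
  moreover have "v \<in> span (insert y Y)" if "?p v = 0" for v
  proof -
    have "p (v - (y \<bullet> p v) *\<^sub>R y) = ?p v"
      by (simp add: linear_diff[OF linear_p] linear_scale[OF linear_p] y)
    also note that
    finally have "p (v - (y \<bullet> p v) *\<^sub>R y) = 0" .
    then show ?thesis using kernel_p by (auto simp: span_insert)
  qed
  ultimately show ?thesis unfolding proj_along_def by blast
qed

section \<open>Removing the innermost quantifier\<close>

context fat_ultrafilter
begin

text \<open>The relations are normalised so that coefficients and points have limits along
  \<open>U\<close>. In the limit the head contributes a multiple of \<open>y\<close>, which the new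
  projection kills, leaving a relation among \<open>Ss\<close>.\<close>

lemma lin_dep_limit:
  assumes p: "proj_along p Y" and nz: "\<forall>\<^sub>F S in U. \<forall>s\<in>S. p (s, 1) \<noteq> 0"
    and y: "norm y = 1" "p y = y"
    and lim: "\<And>e. e > 0 \<Longrightarrow> \<forall>\<^sub>F S in U. \<forall>s\<in>S. dist (sgn (p (s, 1))) y < e"
    and Ss: "\<forall>S\<in>set Ss. compact S"
    and dep: "\<forall>\<^sub>F S in U. lin_dep p (S # Ss)"
  shows "lin_dep (\<lambda>v. p v - (y \<bullet> p v) *\<^sub>R y) Ss"
proof -
  let ?m = "length Ss"
  have linear_p: "linear p" using p unfolding proj_along_def by blast
  \<comment> \<open>The vector of index 0, which may be unbounded as \<open>S\<close> varies, is
    replaced by its direction; fixing the sum of absolute coefficients at 1 excludes a trivial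
    limit.\<close>
  define Q where "Q S s g \<longleftrightarrow> (\<forall>i<?m. s (Suc i) \<in> Ss ! i) \<and> s 0 \<in> S \<and> (\<Sum>i<Suc ?m. \<bar>g i\<bar>) = (1::real)
      \<and> g 0 *\<^sub>R sgn (p (s 0, 1)) + (\<Sum>i<?m. g (Suc i) *\<^sub>R p (s (Suc i), 1)) = 0" for S and s :: "nat \<Rightarrow> 'a" and g
  have exQ: "\<forall>\<^sub>F S in U. \<exists>s g. Q S s g"
    using dep nz
  proof eventually_elim
    case (elim S)
    then obtain s b where s: "\<forall>i<Suc ?m. s i \<in> (S # Ss) ! i" and b: "\<exists>i<Suc ?m. b i \<noteq> (0::real)"
      and sum: "(\<Sum>i<Suc ?m. b i *\<^sub>R p (s i, 1)) = 0"
      by (auto simp: lin_dep_def)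
    have s0: "s 0 \<in> S" using s by auto
    have sS: "s (Suc i) \<in> Ss ! i" if "i < ?m" for i using s that by force
    have n0: "norm (p (s 0, 1)) > 0" using elim s0 by simp
    \<comment> \<open>The norm of the head vector moves into its coefficient; being positive, it
      preserves nontriviality.\<close>
    define h where "h i = (if i = 0 then b 0 * norm (p (s 0, 1)) else b i)" for i
    define N where "N = (\<Sum>i<Suc ?m. \<bar>h i\<bar>)"
    obtain i where "i < Suc ?m" "b i \<noteq> 0" using b by blast
    then have "i < Suc ?m" "h i \<noteq> 0" using n0 by (auto simp: h_def)
    then have N: "N > 0"
      unfolding N_def by (intro sum_pos2[of _ i]) auto
    have b0: "h 0 *\<^sub>R sgn (p (s 0, 1)) = b 0 *\<^sub>R p (s 0, 1)"
      using n0 by (simp add: h_def sgn_div_norm)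
    have "h 0 *\<^sub>R sgn (p (s 0, 1)) + (\<Sum>i<?m. h (Suc i) *\<^sub>R p (s (Suc i), 1)) = 0"
      using sum unfolding sum.lessThan_Suc_shift b0 by (simp add: h_def)
    then have "inverse N *\<^sub>R (h 0 *\<^sub>R sgn (p (s 0, 1)) + (\<Sum>i<?m. h (Suc i) *\<^sub>R p (s (Suc i), 1))) = 0"
      by simp
    then have "(h 0 / N) *\<^sub>R sgn (p (s 0, 1)) + (\<Sum>i<?m. (h (Suc i) / N) *\<^sub>R p (s (Suc i), 1)) = 0"
      by (simp add: scaleR_add_right scaleR_sum_right divide_inverse mult.commute)
    moreover have "(\<Sum>i<Suc ?m. \<bar>h i / N\<bar>) = 1"
    proof -
      have "(\<Sum>i<Suc ?m. \<bar>h i / N\<bar>) = N / N"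
        using N by (simp only: N_def abs_divide sum_divide_distrib abs_of_pos)
      then show ?thesis using N by simp
    qed
    ultimately have "Q S s (\<lambda>i. h i / N)"
      unfolding Q_def using s0 sS by blast
    then show ?case by blast
  qed
  define s where "s S = (SOME s. \<exists>g. Q S s g)" for S
  define g where "g S = (SOME g. Q S (s S) g)" for S
  have "\<forall>\<^sub>F S in U. \<exists>g. Q S (s S) g"
    using exQ
  proof eventually_elim
    case (elim S)
    then show ?case unfolding s_def by (rule someI_ex)
  qed
  then have Q: "\<forall>\<^sub>F S in U. Q S (s S) (g S)"
  proof eventually_elim
    case (elim S)
    then show ?case unfolding g_def by (rule someI_ex)
  qed
  have "\<exists>l. ((\<lambda>S. g S i) \<longlongrightarrow> l) U" if "i < Suc ?m" for i
  proof -
    have "\<forall>\<^sub>F S in U. norm (g S i) \<le> 1"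
      using Q
    proof eventually_elim
      case (elim S)
      have "\<bar>g S i\<bar> \<le> (\<Sum>i<Suc ?m. \<bar>g S i\<bar>)"
        using that by (intro member_le_sum) auto
      then show ?case using elim by (simp add: Q_def)
    qed
    then show ?thesis by (rule ultrafilter_tendsto_bounded[OF ultra])
  qed
  then have "\<forall>i. \<exists>l. i < Suc ?m \<longrightarrow> ((\<lambda>S. g S i) \<longlongrightarrow> l) U" by simp
  from choice[OF this] obtain G where G: "\<And>i. i < Suc ?m \<Longrightarrow> ((\<lambda>S. g S i) \<longlongrightarrow> G i) U" by auto
  have "\<exists>l\<in>Ss ! i. ((\<lambda>S. s S (Suc i)) \<longlongrightarrow> l) U" if "i < ?m" for i
  proof (rule ultrafilter_tendsto_compact[OF ultra])
    show "\<forall>\<^sub>F S in U. s S (Suc i) \<in> Ss ! i" using Q by eventually_elim (use that in \<open>simp add: Q_def\<close>)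
    show "compact (Ss ! i)" using Ss that by simp
  qed
  then have "\<forall>i. \<exists>l. i < ?m \<longrightarrow> l \<in> Ss ! i \<and> ((\<lambda>S. s S (Suc i)) \<longlongrightarrow> l) U" by auto
  from choice[OF this] obtain T where T: "\<And>i. i < ?m \<Longrightarrow> T i \<in> Ss ! i"
      "\<And>i. i < ?m \<Longrightarrow> ((\<lambda>S. s S (Suc i)) \<longlongrightarrow> T i) U" by auto
  have sgn_lim: "((\<lambda>S. sgn (p (s S 0, 1))) \<longlongrightarrow> y) U"
  proof (rule tendstoI)
    fix e :: real assume "e > 0"
    from lim[OF this] Q show "\<forall>\<^sub>F S in U. dist (sgn (p (s S 0, 1))) y < e"
      by eventually_elim (simp add: Q_def)
  qed
  have p_lim: "((\<lambda>S. p (s S (Suc i), 1)) \<longlongrightarrow> p (T i, 1)) U" if "i < ?m" for i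
    using linear_p unfolding linear_conv_bounded_linear
    by (rule bounded_linear.tendsto) (rule tendsto_Pair[OF T(2)[OF that] tendsto_const])
  have "((\<lambda>S. g S 0 *\<^sub>R sgn (p (s S 0, 1)) + (\<Sum>i<?m. g S (Suc i) *\<^sub>R p (s S (Suc i), 1))) \<longlongrightarrow>
      G 0 *\<^sub>R y + (\<Sum>i<?m. G (Suc i) *\<^sub>R p (T i, 1))) U"
  proof (intro tendsto_add tendsto_sum tendsto_scaleR sgn_lim)
    show "((\<lambda>S. g S 0) \<longlongrightarrow> G 0) U" by (rule G) simp
    fix i assume "i \<in> {..<?m}"
    then have "i < ?m" by simp
    then show "((\<lambda>S. g S (Suc i)) \<longlongrightarrow> G (Suc i)) U"
        "((\<lambda>S. p (s S (Suc i), 1)) \<longlongrightarrow> p (T i, 1)) U"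
      by (simp_all add: G p_lim)
  qed
  moreover have "\<forall>\<^sub>F S in U. g S 0 *\<^sub>R sgn (p (s S 0, 1)) + (\<Sum>i<?m. g S (Suc i) *\<^sub>R p (s S (Suc i), 1)) = 0"
    using Q by eventually_elim (simp add: Q_def)
  ultimately have "((\<lambda>S. 0) \<longlongrightarrow> G 0 *\<^sub>R y + (\<Sum>i<?m. G (Suc i) *\<^sub>R p (T i, 1))) U"
    by (rule Lim_transform_eventually)
  then have G0: "G 0 *\<^sub>R y + (\<Sum>i<?m. G (Suc i) *\<^sub>R p (T i, 1)) = 0"
    using U_not_bot by (simp add: tendsto_const_iff)
  have "((\<lambda>S. \<Sum>i<Suc ?m. \<bar>g S i\<bar>) \<longlongrightarrow> (\<Sum>i<Suc ?m. \<bar>G i\<bar>)) U"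
    by (intro tendsto_sum tendsto_rabs G) (simp only: lessThan_iff)
  moreover have "\<forall>\<^sub>F S in U. (\<Sum>i<Suc ?m. \<bar>g S i\<bar>) = 1"
    using Q by eventually_elim (simp add: Q_def)
  ultimately have "((\<lambda>S. 1) \<longlongrightarrow> (\<Sum>i<Suc ?m. \<bar>G i\<bar>)) U"
    by (rule Lim_transform_eventually)
  then have G1: "(\<Sum>i<Suc ?m. \<bar>G i\<bar>) = 1"
    using U_not_bot by (simp add: tendsto_const_iff)
  \<comment> \<open>Otherwise \<open>\<bar>G 0\<bar> = 1\<close> while
    \<open>G 0 *\<^sub>R y = 0\<close>, impossible for a unit vector.\<close>
  have "\<exists>i<?m. G (Suc i) \<noteq> 0"
  proof (rule ccontr)
    assume "\<not> ?thesis"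
    then have "G 0 *\<^sub>R y = 0" "\<bar>G 0\<bar> = 1"
      using G0 G1 unfolding sum.lessThan_Suc_shift by auto
    then show False using y by auto
  qed
  moreover have "(\<Sum>i<?m. G (Suc i) *\<^sub>R (p (T i, 1) - (y \<bullet> p (T i, 1)) *\<^sub>R y)) = 0"
  proof -
    define q where "q v = v - (y \<bullet> v) *\<^sub>R y" for v
    have lq: "linear q"
      unfolding q_def by (rule linearI) (simp_all add: inner_add_right algebra_simps)
    have "y \<bullet> y = 1" using y by (simp add: dot_square_norm)
    then have "q y = 0" by (simp add: q_def)
    have "q (G 0 *\<^sub>R y + (\<Sum>i<?m. G (Suc i) *\<^sub>R p (T i, 1))) = 0"
      unfolding G0 by (rule linear_0[OF lq])
    then have "(\<Sum>i<?m. G (Suc i) *\<^sub>R q (p (T i, 1))) = 0"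
      by (simp add: linear_add[OF lq] linear_scale[OF lq] linear_sum[OF lq] \<open>q y = 0\<close>)
    then show ?thesis by (simp add: q_def)
  qed
  ultimately show ?thesis
    using T(1) unfolding lin_dep_def
    by (intro exI[of _ T] exI[of _ "\<lambda>i. G (Suc i)"] conjI allI impI)
qed

text \<open>Here \<open>p\<close> preserves heights, so a relation between two lifts has
  coefficients with sum 0 and forces equal images; but the images of \<open>S1\<close> are bounded
  and those of \<open>S\<close> are farther out.\<close>

lemma not_lin_dep_escaping:
  assumes p: "proj_along p Y" and Y: "finite Y" "card Y \<le> k"
    and ht: "\<And>w. p (w, 1) \<noteq> 0"
    and far: "\<And>D. \<forall>\<^sub>F S in U. \<forall>s\<in>S. norm (p (s, 1)) > D"
    and S1: "compact S1"
  shows "\<forall>\<^sub>F S in U. \<not> lin_dep p [S, S1]"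
proof -
  have linear_p: "linear p" using p unfolding proj_along_def by blast
  have "bounded ((\<lambda>s. p (s, 1)) ` S1)"
    by (intro compact_imp_bounded compact_continuous_image S1
        continuous_on_compose2[OF linear_continuous_on[OF linear_p[unfolded linear_conv_bounded_linear], of UNIV]]
        continuous_intros) auto
  then obtain D where D: "\<And>s. s \<in> S1 \<Longrightarrow> norm (p (s, 1)) \<le> D"
    unfolding bounded_iff by auto
  from far[of D] show ?thesis
  proof eventually_elim
    case (elim S)
    show ?case
    proof
      assume "lin_dep p [S, S1]"
      then obtain s b where s: "\<forall>i<2. s i \<in> [S, S1] ! i" and b: "\<exists>i<2. b i \<noteq> (0::real)"
        and sum: "(\<Sum>i<2. b i *\<^sub>R p (s i, 1)) = 0"
        by (auto simp: lin_dep_def numeral_2_eq_2)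
      have s01: "s 0 \<in> S" "s 1 \<in> S1" using s[rule_format, of 0] s[rule_format, of 1] by auto
      have eq: "b 0 *\<^sub>R p (s 0, 1) + b 1 *\<^sub>R p (s 1, 1) = 0"
        using sum by (simp add: numeral_2_eq_2)
      have "b 0 \<noteq> 0 \<or> b 1 \<noteq> 0" using b by (auto simp: less_2_cases_iff)
      then have b01: "b 0 + b 1 = 0"
      proof -
        have "snd (p (b 0 *\<^sub>R (s 0, 1) + b 1 *\<^sub>R (s 1, 1))) = snd (b 0 *\<^sub>R (s 0, 1) + b 1 *\<^sub>R (s 1, 1::real))"
          by (rule snd_p[OF p Y ht]) 
        moreover have "p (b 0 *\<^sub>R (s 0, 1) + b 1 *\<^sub>R (s 1, 1)) = 0"
          by (simp only: linear_add[OF linear_p] linear_scale[OF linear_p] eq)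
        ultimately show ?thesis by simp
      qed
      then have "b 1 = - b 0" by simp
      then have "b 0 *\<^sub>R (p (s 0, 1) - p (s 1, 1)) = 0" and "b 0 \<noteq> 0"
        using eq \<open>b 0 \<noteq> 0 \<or> b 1 \<noteq> 0\<close> by (auto simp: scaleR_diff_right)
      then have "p (s 0, 1) = p (s 1, 1)" by simp
      then show False using elim s01 D by force
    qed
  qed
qed

text \<open>Each induction step trades one set of the list for one vector of \<open>Y\<close>, which
  preserves the bound \<open>k + 2\<close>.\<close>

lemma eventually_independent:
  assumes "proj_along p Y" "finite Y" "card Y + Suc m \<le> k + 2"
  shows "ev_seq U (Suc m) (\<lambda>Ss. length Ss = Suc m \<and> (\<forall>S\<in>set Ss. compact S) \<and> \<not> lin_dep p Ss) []"
  using assms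
proof (induction m arbitrary: p Y)
  case 0
  have "\<forall>\<^sub>F S in U. \<forall>s\<in>S. (s, 1::real) \<notin> span Y"
    using 0 by (intro eventually_avoids) auto
  with eventually_compact have "\<forall>\<^sub>F S in U. compact S \<and> \<not> lin_dep p [S]"
  proof eventually_elim
    case (elim S)
    then show ?case using 0(1) by (auto simp: lin_dep_def proj_along_def)
  qed
  then show ?case by simp
next
  case (Suc m)
  have cY: "card Y \<le> k" using Suc.prems by simp
  note nz = p_misses[OF Suc.prems(1,2) cY]
  let ?good = "\<lambda>m p Ss. length Ss = Suc m \<and> (\<forall>S\<in>set Ss. compact S) \<and> \<not> lin_dep p Ss"
  have inner: "ev_seq U (Suc m) (\<lambda>Ss. \<forall>\<^sub>F S in U. ?good (Suc m) p (S # Ss)) []"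
    using limit_direction_or_escape[OF Suc.prems(1,2) cY]
  proof (elim disjE exE conjE)
    fix y assume y: "norm y = 1" "p y = y"
      and lim: "\<forall>e>0. \<forall>\<^sub>F S in U. \<forall>s\<in>S. dist (sgn (p (s, 1))) y < e"
    let ?p = "\<lambda>v. p v - (y \<bullet> p v) *\<^sub>R y"
    have "ev_seq U (Suc m) (?good m ?p) []"
    proof (rule Suc.IH[OF proj_along_extend[OF Suc.prems(1) y]])
      show "finite (insert y Y)" using Suc.prems by simp
      show "card (insert y Y) + Suc m \<le> k + 2"
        using Suc.prems by (simp add: card_insert_if)
    qed
    then show ?thesis
    proof (rule ev_seq_mono)
      fix Ss assume Ss: "?good m ?p Ss"
      \<comment> \<open>The ultrafilter turns the negation of a limit statement into a positive one:
        if dependence does not hold for almost all \<open>S\<close>, then independence does.\<close>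
      then have "\<not> (\<forall>\<^sub>F S in U. lin_dep p (S # Ss))"
        using lin_dep_limit[OF Suc.prems(1) nz y] lim by blast
      then have "\<forall>\<^sub>F S in U. \<not> lin_dep p (S # Ss)"
        unfolding not_eventually_ultrafilter[OF ultra] .
      with eventually_compact show "\<forall>\<^sub>F S in U. ?good (Suc m) p (S # Ss)"
        by eventually_elim (use Ss in auto)
    qed
  next
    assume far: "card Y = k" "\<forall>w. p (w, 1) \<noteq> 0" "\<forall>D. \<forall>\<^sub>F S in U. \<forall>s\<in>S. norm (p (s, 1)) > D"
    \<comment> \<open>With \<open>card Y = k\<close> the bound leaves room for two sets only, which
      is what \<open>not_lin_dep_escaping\<close> handles.\<close>
    then have m: "m = 0" using Suc.prems by simp
    have "\<forall>\<^sub>F S1 in U. \<forall>\<^sub>F S in U. ?good (Suc m) p [S, S1]"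
      using eventually_compact
    proof eventually_elim
      case (elim S1)
      have "\<forall>\<^sub>F S in U. \<not> lin_dep p [S, S1]"
        using not_lin_dep_escaping[OF Suc.prems(1,2) cY _ _ elim] far by blast
      with eventually_compact show ?case by eventually_elim (use elim m in auto)
    qed
    then show ?thesis by (simp add: m)
  qed
  then show ?case unfolding ev_seq_Suc_inner .
qed

end


section \<open>Flats and spans of lifts\<close>

lemma affine_height_one: "affine {x::'a::real_vector. (x, 1::real) \<in> span Y}"
  unfolding affine_def
proof (intro ballI allI impI)
  fix x y :: 'a and u v :: real
  assume "x \<in> {x. (x, 1) \<in> span Y}" "y \<in> {x. (x, 1) \<in> span Y}" "u + v = 1"
  then have "u *\<^sub>R (x, 1) + v *\<^sub>R (y, 1) \<in> span Y"
    by (intro span_add span_scale) simp_all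
  then show "u *\<^sub>R x + v *\<^sub>R y \<in> {x. (x, 1) \<in> span Y}"
    using \<open>u + v = 1\<close> by simp
qed

text \<open>An affine basis of \<open>A\<close> extends to one of the whole space; a set of size
  \<open>k + 1\<close> between the two spans the flat.\<close>

lemma k_flat_extend:
  fixes A :: "'a::euclidean_space set"
  assumes "aff_dim A \<le> int k" "k \<le> DIM('a)"
  shows "\<exists>K. k_flat k K \<and> A \<subseteq> K"
proof -
  obtain b where b: "b \<subseteq> A" "\<not> affine_dependent b" "affine hull A = affine hull b"
    using affine_basis_exists by blast
  have "\<exists>T. \<not> affine_dependent T \<and> b \<subseteq> T \<and> affine hull T = affine hull (UNIV :: 'a set)"
  proof (cases "b = {}")
    case True
    then show ?thesis using affine_basis_exists[of "UNIV :: 'a set"] by (metis empty_subsetI)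
  next
    case False
    from extend_to_affine_basis_nonempty[OF b(2) subset_UNIV this] show ?thesis by blast
  qed
  then obtain T where T: "\<not> affine_dependent T" "b \<subseteq> T" "affine hull T = affine hull (UNIV :: 'a set)"
    by blast
  have "int (card b) = aff_dim A + 1"
    using aff_dim_affine_independent[OF b(2)] aff_dim_affine_hull[of A] aff_dim_affine_hull[of b]
    by (simp only: b(3))
  then have "card b \<le> k + 1" using assms by linarith
  moreover have "int (card T) = DIM('a) + 1"
    using aff_dim_affine_independent[OF T(1)] aff_dim_affine_hull[of T]
    by (simp only: T(3)) simp
  then have "k + 1 \<le> card T" using assms by linarith
  ultimately obtain B where B: "b \<subseteq> B" "B \<subseteq> T" "card B = k + 1"
    using exists_subset_between[of b "k + 1" T] T(2) aff_independent_finite[OF T(1)] by auto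
  have "\<not> affine_dependent B" using T(1) B(2) affine_dependent_subset by blast
  from aff_dim_affine_independent[OF this] B(3) have "aff_dim (affine hull B) = int k"
    by simp
  moreover have "A \<subseteq> affine hull B"
    using b(3) hull_mono[OF B(1)] hull_subset[of A affine] by blast
  ultimately show ?thesis unfolding k_flat_def using affine_affine_hull by blast
qed

text \<open>The origin lies outside the affine hull of the section at height 1, so adding it raises
  the dimension by one, still within the span of \<open>Y\<close>. Hence the section has dimension
  at most \<open>k\<close>.\<close>

lemma k_flat_containing_span_section:
  fixes Y :: "('a::euclidean_space \<times> real) set"
  assumes "finite Y" "card Y \<le> k + 1" "k \<le> DIM('a)"
  shows "\<exists>K. k_flat k K \<and> {x. (x, 1) \<in> span Y} \<subseteq> K"
proof (rule k_flat_extend)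
  let ?A = "{x. (x, 1) \<in> span Y}"
  let ?B = "(\<lambda>x. (x, 1::real)) ` ?A"
  have "linear (\<lambda>x::'a. (x, 0::real))"
    by (rule linearI) auto
  then have "aff_dim ((\<lambda>x. (x, 0::real)) ` ?A) = aff_dim ?A"
    by (rule aff_dim_injective_linear_image) (simp add: inj_on_def)
  moreover have "?B = (+) (0, 1) ` (\<lambda>x. (x, 0::real)) ` ?A"
    by (simp add: image_image)
  ultimately have eq: "aff_dim ?B = aff_dim ?A"
    by (simp only: aff_dim_translation_eq)
  have "affine {z :: 'a \<times> real. snd z = 1}"
    by (auto simp: affine_def)
  then have "affine hull ?B \<subseteq> {z. snd z = 1}"
    by (intro hull_minimal) auto
  then have "0 \<notin> affine hull ?B" by auto
  then have "aff_dim (insert 0 ?B) = aff_dim ?A + 1"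
    by (simp only: aff_dim_insert eq if_False)
  moreover have "aff_dim (insert 0 ?B) \<le> aff_dim (span Y)"
    by (intro aff_dim_subset) (auto simp: span_zero)
  moreover have "aff_dim (span Y) \<le> int (card Y)"
    using dim_le_card'[OF assms(1)] by (simp add: aff_dim_subspace)
  ultimately show "aff_dim ?A \<le> int k" using assms(2) by linarith
qed (rule assms)

text \<open>The \<open>k + 2\<close> lifts lie in the span of the lifts of an affine basis of
  \<open>K\<close>, which has only \<open>k + 1\<close> points.\<close>

lemma lin_dep_of_k_flat:
  fixes K :: "'a::euclidean_space set"
  assumes K: "k_flat k K" and len: "length Ss = k + 2" and pierce: "\<forall>S\<in>set Ss. pierces K S"
  shows "lin_dep (\<lambda>v. v) Ss"
proof -
  have "\<forall>i<k + 2. \<exists>x. x \<in> K \<inter> Ss ! i"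
    using pierce len unfolding pierces_def by (metis ex_in_conv nth_mem)
  then obtain s where s: "\<And>i. i < k + 2 \<Longrightarrow> s i \<in> K \<and> s i \<in> Ss ! i"
    by (metis Int_iff)
  obtain b where b: "\<not> affine_dependent b" "affine hull K = affine hull b"
    using affine_basis_exists by blast
  have fin: "finite b" using b(1) by (rule aff_independent_finite)
  have "int (card b) = k + 1"
    using aff_dim_affine_independent[OF b(1)] aff_dim_affine_hull[of K] aff_dim_affine_hull[of b] K
    unfolding k_flat_def by (simp only: b(2))
  then have cb: "card b = k + 1" by linarith
  let ?h = "\<lambda>x::'a. (x, 1::real)"
  have "affine hull b \<subseteq> {x. ?h x \<in> span (?h ` b)}"
    by (rule hull_minimal) (auto intro: span_base affine_height_one)
  then have span: "?h (s i) \<in> span (?h ` b)" if "i < k + 2" for i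
    using s[OF that] b(2) hull_subset[of K affine] by blast
  have "\<exists>c :: nat \<Rightarrow> real. (\<exists>i<k + 2. c i \<noteq> 0) \<and> (\<Sum>i<k + 2. c i *\<^sub>R ?h (s i)) = 0"
  proof (cases "inj_on s {..<k + 2}")
    case True
    then have inj: "inj_on (\<lambda>i. ?h (s i)) {..<k + 2}" by (auto simp: inj_on_def)
    let ?V = "(\<lambda>i. ?h (s i)) ` {..<k + 2}"
    have "dependent ?V"
    proof (rule ccontr)
      assume "independent ?V"
      then have "card ?V \<le> card (?h ` b)"
        using independent_span_bound[of "?h ` b" ?V] fin span by auto
      also have "\<dots> \<le> k + 1" using card_image_le[OF fin, of ?h] cb by simp
      finally show False using card_image[OF inj] by simp
    qed
    then obtain u v where uv: "v \<in> ?V" "u v \<noteq> 0" "(\<Sum>v\<in>?V. u v *\<^sub>R v) = 0"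
      by (auto simp only: dependent_finite[OF finite_imageI[OF finite_lessThan]])
    then have "(\<Sum>i<k + 2. u (?h (s i)) *\<^sub>R ?h (s i)) = 0"
      by (simp only: sum.reindex[OF inj] o_def)
    then show ?thesis using uv(1,2) by (intro exI[of _ "\<lambda>i. u (?h (s i))"]) auto
  next
    case False
    \<comment> \<open>Coinciding points escape the dimension count for sets, but
      \<open>lin_dep\<close> concerns indexed families, so the coefficients 1 and -1 give a
      relation.\<close>
    then obtain i j where ij: "i < k + 2" "j < k + 2" "i \<noteq> j" "s i = s j"
      by (auto simp: inj_on_def)
    let ?c = "\<lambda>l. if l = i then 1 else if l = j then - 1 else (0::real)"
    have "(\<Sum>l<k + 2. ?c l *\<^sub>R ?h (s l)) = (\<Sum>l\<in>{i, j}. ?c l *\<^sub>R ?h (s l))"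
      using ij by (intro sum.mono_neutral_right) (auto simp: zero_prod_def)
    also have "\<dots> = 0" using ij by (simp add: zero_prod_def)
    finally show ?thesis using ij(1) by (intro exI[of _ ?c]) auto
  qed
  then obtain c :: "nat \<Rightarrow> real" where "(\<exists>i<k + 2. c i \<noteq> 0) \<and> (\<Sum>i<k + 2. c i *\<^sub>R ?h (s i)) = 0" ..
  then show ?thesis
    using s unfolding lin_dep_def len by (intro exI[of _ s] exI[of _ c]) simp
qed

section \<open>Concentric balls from the condition number\<close>

lemma fat_of_cond_number:
  fixes S :: "'a::euclidean_space set"
  assumes \<rho>: "\<rho> > 0" and cond: "ennreal \<rho> < cond_number S"
  shows "\<exists>c r. 0 < r \<and> cball c r \<subseteq> S \<and> S \<subseteq> cball c (2 / \<rho> * r)"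
proof -
  \<comment> \<open>By the conventions for division in \<open>ennreal\<close>, a zero in-radius or
    an infinite out-radius would give condition number 0.\<close>
  have in0: "in_radius S \<noteq> 0" using cond by (auto simp: cond_number_def)
  have outf: "out_radius S \<noteq> top" using cond by (auto simp: cond_number_def)
  have "ennreal \<rho> * out_radius S < in_radius S"
  proof (rule ccontr)
    assume "\<not> ?thesis"
    then have "in_radius S \<le> ennreal \<rho> * out_radius S" by simp
    then have "cond_number S \<le> ennreal \<rho>"
      using in0 outf unfolding cond_number_def
      by (cases "out_radius S = 0") (auto simp: divide_le_posI_ennreal zero_less_iff_neq_zero mult.commute)
    then show False using cond by simp
  qed
  then obtain c r where r: "0 \<le> r" "cball c r \<subseteq> S" "ennreal \<rho> * out_radius S < ennreal r"
    unfolding in_radius_def less_SUP_iff by blast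
  have "0 < ennreal r" using r(3) by (rule order.strict_trans1[OF zero_le])
  then have r0: "0 < r" by simp
  have "out_radius S < ennreal (r / \<rho>)"
  proof (rule ccontr)
    assume "\<not> ?thesis"
    then have "ennreal \<rho> * ennreal (r / \<rho>) \<le> ennreal \<rho> * out_radius S"
      by (intro mult_left_mono) auto
    also have "ennreal \<rho> * ennreal (r / \<rho>) = ennreal r"
      using \<rho> r0 by (simp flip: ennreal_mult)
    finally show False using r(3) by simp
  qed
  then obtain R c' where R: "0 \<le> R" "S \<subseteq> cball c' R" "ennreal R < ennreal (r / \<rho>)"
    unfolding out_radius_def INF_less_iff by blast
  have R_less: "R < r / \<rho>" using R by (simp add: ennreal_less_iff)
  have "c \<in> S" using r0 r(2) by auto
  \<comment> \<open>The enclosing ball has another centre \<open>c'\<close>; recentring it at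
    \<open>c\<close>, a point of \<open>S\<close>, doubles the radius, hence the 2 in
    \<open>2 / \<rho>\<close>.\<close>
  have "S \<subseteq> cball c (2 / \<rho> * r)"
  proof
    fix x assume "x \<in> S"
    then have "dist c' x \<le> R" "dist c' c \<le> R" using R(2) \<open>c \<in> S\<close> by auto
    then have "dist c x \<le> 2 * R" using dist_triangle2[of c x c'] by (simp add: dist_commute)
    then show "x \<in> cball c (2 / \<rho> * r)" using R_less by simp
  qed
  then show ?thesis using r0 r(2) by blast
qed

section \<open>Diagonal choice of a heterochromatic sequence\<close>

lemma sorted_list_of_set_insert_max:
  fixes A :: "nat set"
  assumes "finite A" "\<And>a. a \<in> A \<Longrightarrow> a < b"
  shows "sorted_list_of_set (insert b A) = sorted_list_of_set A @ [b]"
proof -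
  have "sorted_list_of_set (set (sorted_list_of_set A @ [b])) = sorted_list_of_set A @ [b]"
    by (rule sorted_list_of_set.idem_if_sorted_distinct)
       (use assms in \<open>auto simp: sorted_append intro: less_imp_le\<close>)
  then show ?thesis using assms(1) by simp
qed

text \<open>Each new set must work for all selections of earlier positions: there are only finitely
  many sets \<open>J\<close> of positions below \<open>n\<close>, so \<open>U\<close>-almost every
  set serves all of them at once.\<close>

lemma heterochromatic_sequence_exists:
  assumes U: "U \<noteq> bot" and P: "ev_seq U m P []"
    and tails: "\<And>N. \<forall>\<^sub>F S in U. \<exists>n\<ge>N. S \<in> F n"
  shows "\<exists>B. heterochromatic_seq F B \<and>
    (\<forall>J. finite J \<longrightarrow> card J = m \<longrightarrow> P (map B (rev (sorted_list_of_set J))))"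
proof -
  \<comment> \<open>The reversal puts the set of largest position at the head, matching the order in
    which \<open>ev_seq\<close> builds its list.\<close>
  define l where "l f J = map (\<lambda>j. snd (f j)) (rev (sorted_list_of_set J))"
    for f :: "nat \<Rightarrow> nat \<times> 'a set" and J
  \<comment> \<open>A pair holds the index of a family and a member of it. For a set
    \<open>J\<close> of past positions, \<open>m - card J\<close> quantifiers remain open; the new
    set discharges one of them.\<close>
  define R where "R f n r \<longleftrightarrow> snd r \<in> F (fst r) \<and> (\<forall>j<n. fst (f j) < fst r) \<and>
      (\<forall>J\<subseteq>{..<n}. card J < m \<longrightarrow> ev_seq U (m - card J) P (l f J) \<longrightarrow>
        ev_seq U (m - Suc (card J)) P (snd r # l f J))" for f n r
  have "\<exists>f. \<forall>n. R f n (f n)"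
  proof (rule dependent_wellorder_choice)
    fix r :: "nat \<times> 'a set" and f g :: "nat \<Rightarrow> nat \<times> 'a set" and n
    assume eq: "\<And>j. j < n \<Longrightarrow> f j = g j"
    have "l f J = l g J" if "J \<subseteq> {..<n}" for J
      using that finite_subset[OF that] eq unfolding l_def by (auto intro!: map_cong)
    then show "R f n r = R g n r" using eq unfolding R_def by (simp cong: conj_cong imp_cong)
  next
    fix n and f :: "nat \<Rightarrow> nat \<times> 'a set"
    let ?\<J> = "{J. J \<subseteq> {..<n} \<and> card J < m \<and> ev_seq U (m - card J) P (l f J)}"
    have "\<forall>\<^sub>F S in U. \<forall>J\<in>?\<J>. ev_seq U (m - Suc (card J)) P (S # l f J)"
    proof (rule eventually_ball_finite)
      show "finite ?\<J>" by (rule finite_subset[of _ "Pow {..<n}"]) auto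
      show "\<forall>J\<in>?\<J>. \<forall>\<^sub>F S in U. ev_seq U (m - Suc (card J)) P (S # l f J)"
      proof
        fix J assume J: "J \<in> ?\<J>"
        then have Suc: "m - card J = Suc (m - Suc (card J))" by auto
        have "ev_seq U (m - card J) P (l f J)" using J by simp
        then show "\<forall>\<^sub>F S in U. ev_seq U (m - Suc (card J)) P (S # l f J)"
          unfolding Suc ev_seq.simps .
      qed
    qed
    with tails[of "Suc (\<Sum>j<n. fst (f j))"]
    have "\<forall>\<^sub>F S in U. \<exists>r. R f n (r, S)"
    proof eventually_elim
      case (elim S)
      then obtain i where i: "i \<ge> Suc (\<Sum>j<n. fst (f j))" "S \<in> F i" by blast
      have "fst (f j) < i" if "j < n" for j
        using i(1) member_le_sum[of j "{..<n}" "\<lambda>j. fst (f j)"] that by simp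
      then have "R f n (i, S)" using i(2) elim(2) unfolding R_def fst_conv snd_conv by blast
      then show ?case by blast
    qed
    then show "\<exists>r. R f n r" using eventually_happens'[OF U] by blast
  qed
  then obtain f where f: "\<And>n. R f n (f n)" by blast
  \<comment> \<open>Induction by adding the largest position \<open>b\<close>: the choice made at
    \<open>b\<close> took care of every \<open>A\<close> below it.\<close>
  have ev_l: "ev_seq U (m - card J) P (l f J)" if "finite J" "card J \<le> m" for J
    using that
  proof (induction J rule: finite_linorder_max_induct)
    case empty
    then show ?case using P by (simp add: l_def)
  next
    case (insert b A)
    have "b \<notin> A" using insert by auto
    then have card: "card (insert b A) = Suc (card A)" using insert by simp
    have "l f (insert b A) = snd (f b) # l f A"
      using sorted_list_of_set_insert_max[of A b] insert by (simp add: l_def)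
    moreover have "ev_seq U (m - card A) P (l f A)" using insert card by simp
    then have "ev_seq U (m - Suc (card A)) P (snd (f b) # l f A)"
    proof -
      have "A \<subseteq> {..<b}" "card A < m" using insert card by auto
      with f[of b] show ?thesis
        using \<open>ev_seq U (m - card A) P (l f A)\<close> unfolding R_def by blast
    qed
    ultimately show ?case using card by simp
  qed
  have "P (map (\<lambda>j. snd (f j)) (rev (sorted_list_of_set J)))" if "finite J" "card J = m" for J
  proof -
    have "ev_seq U 0 P (l f J)" using ev_l[OF that(1)] that(2) by simp
    then show ?thesis by (simp add: l_def)
  qed
  moreover have "strict_mono (\<lambda>n. fst (f n))"
    using f unfolding R_def strict_mono_def by blast
  then have "heterochromatic_seq F (\<lambda>j. snd (f j))"
    using f unfolding heterochromatic_seq_def R_def by blast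
  ultimately show ?thesis by blast
qed

section \<open>Piercing by finitely many flats\<close>

lemma finitely_many_flats_pierce:
  fixes F :: "nat \<Rightarrow> 'a::euclidean_space set set"
  assumes k: "k \<le> DIM('a)"
    and closed_convex: "\<And>n S. S \<in> F n \<Longrightarrow> closed S \<and> convex S"
    and het: "heterochromatic_property k F"
    and fat: "liminf (\<lambda>n. family_cond_number (F n)) > 0"
  shows "\<exists>T N. finite T \<and> (\<forall>K\<in>T. k_flat k K) \<and> (\<forall>n\<ge>N. \<forall>S\<in>F n. \<exists>K\<in>T. pierces K S)"
proof (rule ccontr)
  assume none: "\<not> ?thesis"
  \<comment> \<open>The filter generated by the tails of the sequence and, for each k-flat, the
    collection of sets missing it; \<open>T\<close> lists the finitely many flats used.\<close>
  define E where "E P \<longleftrightarrow> (\<exists>N T. finite T \<and> (\<forall>K\<in>T. k_flat k K) \<and>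
    (\<forall>n\<ge>N. \<forall>S\<in>F n. (\<forall>K\<in>T. \<not> pierces K S) \<longrightarrow> P S))" for P
  have "is_filter E"
  proof
    show "E (\<lambda>x. True)" unfolding E_def by (rule exI[of _ 0], rule exI[of _ "{}"]) simp
    show "E (\<lambda>x. P x \<and> Q x)" if P: "E P" and Q: "E Q" for P Q
    proof -
      obtain N T where T: "finite T" "\<forall>K\<in>T. k_flat k K"
        and NP: "\<forall>n\<ge>N. \<forall>S\<in>F n. (\<forall>K\<in>T. \<not> pierces K S) \<longrightarrow> P S"
        using P unfolding E_def by (elim exE conjE)
      obtain N' T' where T': "finite T'" "\<forall>K\<in>T'. k_flat k K"
        and NQ: "\<forall>n\<ge>N'. \<forall>S\<in>F n. (\<forall>K\<in>T'. \<not> pierces K S) \<longrightarrow> Q S"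
        using Q unfolding E_def by (elim exE conjE)
      show ?thesis
        unfolding E_def
      proof (intro exI conjI allI impI ballI)
        fix n S assume n: "max N N' \<le> n" "S \<in> F n" and S: "\<forall>K\<in>T \<union> T'. \<not> pierces K S"
        have N: "N \<le> n" "N' \<le> n" using n(1) by simp_all
        show "P S"
          using NP[THEN spec, THEN mp, OF N(1), THEN bspec, OF n(2), THEN mp] S by simp
        show "Q S"
          using NQ[THEN spec, THEN mp, OF N(2), THEN bspec, OF n(2), THEN mp] S by simp
      next
        show "finite (T \<union> T')" using T(1) T'(1) by simp
        fix K assume "K \<in> T \<union> T'"
        then show "k_flat k K" using T(2) T'(2) by (elim UnE) simp_all
      qed
    qed
    show "E Q" if imp: "\<forall>x. P x \<longrightarrow> Q x" and EP: "E P" for P Q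
    proof -
      obtain N T where T: "finite T" "\<forall>K\<in>T. k_flat k K"
        and NP: "\<forall>n\<ge>N. \<forall>S\<in>F n. (\<forall>K\<in>T. \<not> pierces K S) \<longrightarrow> P S"
        using EP unfolding E_def by (elim exE conjE)
      have "\<forall>n\<ge>N. \<forall>S\<in>F n. (\<forall>K\<in>T. \<not> pierces K S) \<longrightarrow> Q S"
      proof (intro allI impI ballI)
        fix n S assume n: "N \<le> n" "S \<in> F n" and S: "\<forall>K\<in>T. \<not> pierces K S"
        have "P S"
          using NP[THEN spec, THEN mp, OF n(1), THEN bspec, OF n(2), THEN mp] S .
        then show "Q S" by (rule imp[THEN spec, THEN mp])
      qed
      with T show ?thesis
        unfolding E_def by (intro exI[of _ N] exI[of _ T] conjI)
    qed
  qed
  then have ev: "eventually P (Abs_filter E) \<longleftrightarrow> E P" for P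
    by (rule eventually_Abs_filter)
  \<comment> \<open>The improper filter would mean that some finite \<open>T\<close> pierces every
    set in a tail, contrary to \<open>none\<close>.\<close>
  have "Abs_filter E \<noteq> bot"
  proof
    assume "Abs_filter E = bot"
    then have "E (\<lambda>x. False)" using ev[of "\<lambda>x. False"] by simp
    then obtain N T where T: "finite T" "\<forall>K\<in>T. k_flat k K"
      and N: "\<forall>n\<ge>N. \<forall>S\<in>F n. (\<forall>K\<in>T. \<not> pierces K S) \<longrightarrow> False"
      unfolding E_def by (elim exE conjE)
    have "\<forall>n\<ge>N. \<forall>S\<in>F n. \<exists>K\<in>T. pierces K S"
      using N by simp
    with T have "\<exists>T N. finite T \<and> (\<forall>K\<in>T. k_flat k K) \<and> (\<forall>n\<ge>N. \<forall>S\<in>F n. \<exists>K\<in>T. pierces K S)"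
      by (intro exI[of _ T] exI[of _ N] conjI)
    then show False using none by contradiction
  qed
  from ultrafilter_exists[OF this] obtain U where U: "U \<le> Abs_filter E" "ultrafilter U" by blast
  have U_ev: "eventually P U" if "E P" for P
    by (rule filter_leD[OF U(1)]) (simp add: ev that)
  obtain \<rho> where "0 < \<rho>" and \<rho>: "\<forall>\<^sub>F n in sequentially. ennreal \<rho> < family_cond_number (F n)"
  proof -
    obtain y where y: "0 < y" "y < liminf (\<lambda>n. family_cond_number (F n))"
      using dense[OF fat] by blast
    have "y < top" using y(2) top_greatest by (rule order.strict_trans2)
    then have "y = ennreal (enn2real y)" "0 < enn2real y"
      using y(1) by (simp_all add: enn2real_positive_iff)
    moreover have "\<forall>\<^sub>F n in sequentially. y < family_cond_number (F n)"
      using y(2) by (rule less_LiminfD)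
    ultimately show ?thesis using that[of "enn2real y"] by simp
  qed
  then obtain N where N: "\<And>n. n \<ge> N \<Longrightarrow> ennreal \<rho> < family_cond_number (F n)"
    by (auto simp: eventually_sequentially)
  define M where "M = 2 / \<rho>"
  have fatS: "\<exists>c r. 0 < r \<and> cball c r \<subseteq> S \<and> S \<subseteq> cball c (M * r)" if "n \<ge> N" "S \<in> F n" for n S
  proof -
    have "family_cond_number (F n) \<le> cond_number S"
      unfolding family_cond_number_def using that(2) by (rule INF_lower)
    with N[OF that(1)] have "ennreal \<rho> < cond_number S" by (rule order.strict_trans2)
    from fat_of_cond_number[OF \<open>0 < \<rho>\<close> this] show ?thesis unfolding M_def .
  qed
  interpret fat_ultrafilter U k M
  proof
    show "ultrafilter U" by (rule U)
    have E_tail: "E P" if "\<And>n S. n \<ge> N \<Longrightarrow> S \<in> F n \<Longrightarrow> P S" for P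
      unfolding E_def using that by (intro exI[of _ N] exI[of _ "{}"]) simp
    show "\<forall>\<^sub>F S in U. \<exists>c r. 0 < r \<and> cball c r \<subseteq> S \<and> S \<subseteq> cball c (M * r)"
      using fatS by (rule U_ev[OF E_tail])
    have "compact S" if nS: "n \<ge> N" "S \<in> F n" for n S
    proof -
      obtain c r where "S \<subseteq> cball c (M * r)" using fatS[OF nS] by (elim exE conjE)
      then have "bounded S" by (rule bounded_subset[OF bounded_cball])
      then show ?thesis using closed_convex[OF nS(2)] by (simp add: compact_eq_bounded_closed)
    qed
    then show "\<forall>\<^sub>F S in U. compact S"
      by (rule U_ev[OF E_tail])
    show "\<forall>\<^sub>F S in U. convex S"
      by (rule U_ev[OF E_tail]) (rule conjunct2[OF closed_convex])
    fix Y :: "('a \<times> real) set" assume Y: "finite Y" "card Y \<le> k + 1"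
    \<comment> \<open>The single flat \<open>K\<close> contains the section of the span of
      \<open>Y\<close>, so the lift of a set missing \<open>K\<close> misses the span.\<close>
    obtain K where K: "k_flat k K" "{x. (x, 1) \<in> span Y} \<subseteq> K"
      using k_flat_containing_span_section[OF Y k] by blast
    show "\<forall>\<^sub>F S in U. \<forall>s\<in>S. (s, 1::real) \<notin> span Y"
    proof (rule U_ev, unfold E_def, rule exI[of _ 0], rule exI[of _ "{K}"], intro conjI)
      have "\<forall>s\<in>S. (s, 1) \<notin> span Y" if "\<forall>K\<in>{K}. \<not> pierces K S" for S
      proof
        fix s assume "s \<in> S"
        then have "s \<notin> K" using that by (auto simp: pierces_def)
        then show "(s, 1) \<notin> span Y" using K(2) by blast
      qed
      then show "\<forall>n\<ge>0. \<forall>S\<in>F n. (\<forall>K\<in>{K}. \<not> pierces K S) \<longrightarrow> (\<forall>s\<in>S. (s, 1::real) \<notin> span Y)"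
        by simp
    qed (use K(1) in simp_all)
  qed
  have tails: "\<forall>\<^sub>F S in U. \<exists>n\<ge>N. S \<in> F n" for N
  proof (rule U_ev, unfold E_def, rule exI[of _ N], rule exI[of _ "{}"], intro conjI allI impI ballI)
    fix n S assume "N \<le> n" "S \<in> F n"
    then show "\<exists>n\<ge>N. S \<in> F n" by (intro exI[of _ n] conjI)
  qed simp_all
  \<comment> \<open>Starting with the identity and the empty \<open>Y\<close>, the bound
    \<open>k + 2\<close> is met with \<open>m = k + 1\<close>.\<close>
  have "proj_along (\<lambda>v::'a \<times> real. v) {}"
    by (simp add: proj_along_def linear_ident)
  from eventually_independent[OF this, of "k + 1"]
  have "ev_seq U (k + 2) (\<lambda>Ss. length Ss = k + 2 \<and> (\<forall>S\<in>set Ss. compact S) \<and> \<not> lin_dep (\<lambda>v. v) Ss) []"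
    by simp
  from heterochromatic_sequence_exists[OF U_not_bot this tails]
  obtain B where B: "heterochromatic_seq F B"
    and indep: "\<And>J. finite J \<Longrightarrow> card J = k + 2 \<Longrightarrow> \<not> lin_dep (\<lambda>v. v) (map B (rev (sorted_list_of_set J)))"
    by blast
  have "k_dependent k B"
    using het B unfolding heterochromatic_property_def by simp
  then obtain K J where J: "k_flat k K" "card J = k + 2" "\<forall>j\<in>J. pierces K (B j)"
    unfolding k_dependent_def by (elim exE conjE)
  \<comment> \<open>Infinite sets have cardinality 0, so \<open>card J = k + 2\<close> forces
    finiteness.\<close>
  have "finite J" using J(2) by (intro card_ge_0_finite) simp
  moreover have "lin_dep (\<lambda>v. v) (map B (rev (sorted_list_of_set J)))"
    using J \<open>finite J\<close> by (intro lin_dep_of_k_flat[OF J(1)]) auto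
  ultimately show False using indep J(2) by blast
qed

theorem theorem11:
  fixes F :: "nat \<Rightarrow> (real ^ 'd) set set" and k :: nat
  assumes "k < CARD('d)"
    and "\<And>n S. S \<in> F n \<Longrightarrow> closed S \<and> convex S"
    and "heterochromatic_property k F"
    and "liminf (\<lambda>n. family_cond_number (F n)) > 0"
  shows "\<exists>T I. finite T \<and> (\<forall>K\<in>T. k_flat k K) \<and> finite (UNIV - I)
           \<and> (\<forall>n\<in>I. \<forall>S\<in>F n. \<exists>K\<in>T. pierces K S)"
proof -
  have "k \<le> DIM(real ^ 'd)" using assms(1) by simp
  then have "\<exists>T N. finite T \<and> (\<forall>K\<in>T. k_flat k K) \<and> (\<forall>n\<ge>N. \<forall>S\<in>F n. \<exists>K\<in>T. pierces K S)"
    by (rule finitely_many_flats_pierce) (fact assms)+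
  then obtain T N where T: "finite T" "\<forall>K\<in>T. k_flat k K" "\<forall>n\<ge>N. \<forall>S\<in>F n. \<exists>K\<in>T. pierces K S"
    by (elim exE conjE)
  have "UNIV - {N..} = {..<N}" by auto
  then have "finite (UNIV - {N..})" by simp
  with T show ?thesis by (intro exI[of _ T] exI[of _ "{N..}"] conjI) simp_all
qed

end
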